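(* Let $N\ge2$, let $W_1,\ldots,W_N$ be invertible bounded linear operators on $\mathcal H$, and let $U\in B(\mathcal H)$ be a unitary operator. For each $l\in\{1,\ldots,N\}$ let $T_l$ denote the operator $T_{U,W_l}$ on $B(\mathcal H)$. Let $r_1,\ldots,r_N\in\mathbb N$ with $0<r_1<r_2<\cdots<r_N$. Then (ii) implies (i), where: (i) $(T_1^{*})^{r_1},\ldots,(T_N^{*})^{r_N}$ are d-topologically transitive on $B(\mathcal H)^*$. (ii) For every $n\in\mathbb N$ there exist sequences $\{D_k\}_{k=1}^\infty,\{G_k^{(1)}\}_{k=1}^\infty,\ldots,\{G_k^{(N)}\}_{k=1}^\infty$ of operators in $B(\mathcal H)$ and a strictly increasing sequence $\{n_k\}_{k=1}^\infty\subseteq\mathbb N$ such that, in the strong operator topology, $\lim_{k\to\infty}D_k=\lim_{k\to\infty}G_k^{(l)}=P_n$ for all $l\in\{1,\ldots,N\}$, and $$\lim_{k\to\infty}\|D_kW_l^{r_ln_k}\|=\lim_{k\to\infty}\|G_k^{(l)}W_l^{-r_ln_k}\|=0$$ for all $l\in\{1,\ldots,N\}$; and moreover, for all distinct $s,l\in\{1,\ldots,N\}$, $$\lim_{k\to\infty}\|G_k^{(s)}W_s^{-r_sn_k}W_l^{r_ln_k}\|=0.$$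
   Context: $\mathcal H$ is a separable Hilbert space with an orthonormal basis $\{e_j\}_{j\in\mathbb N}$; $P_n$ is the orthogonal projection onto $L_n:=\mathrm{span}\{e_1,\ldots,e_n\}$. $B(\mathcal H)$ is the set of bounded linear operators on $\mathcal H$. For $U,W\in B(\mathcal H)$, $T_{U,W}:B(\mathcal H)\to B(\mathcal H)$ is given by $T_{U,W}(F):=WFU$. $B(\mathcal H)^*$ denotes the dual of $(B(\mathcal H),\mathrm{SOT})$ (the linear functionals on $B(\mathcal H)$ continuous for the strong operator topology), equipped with the weak-star topology. The operator $T_{U,W}^*$ on $B(\mathcal H)^*$ is the dual operator: $(T_{U,W}^*\varphi)(F)=\varphi(WFU)$ for $\varphi\in B(\mathcal H)^*$, $F\in B(\mathcal H)$. Operators $A_1,\ldots,A_N$ on a topological vector space $\mathcal X$ are d-topologically transitive if for any nonempty open subsets $O,V_1,\ldots,V_N$ of $\mathcal X$ there exists $n\in\mathbb N$ with $O\cap A_1^{-n}(V_1)\cap\cdots\cap A_N^{-n}(V_N)\ne\varnothing$. *)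

theory Defs
  imports "HOL-Analysis.Analysis"
begin

text \<open>
  Complex Hilbert spaces, on top of the real Banach space class. The inner product is linear in its
  first argument.
\<close>

class complex_hilbert_space = banach +
  fixes scaleC :: "complex \<Rightarrow> 'a \<Rightarrow> 'a" (infixr "*\<^sub>C" 75)
    and cinner :: "'a \<Rightarrow> 'a \<Rightarrow> complex"
  assumes scaleC_add_right: "a *\<^sub>C (x + y) = a *\<^sub>C x + a *\<^sub>C y"
    and scaleC_add_left: "(a + b) *\<^sub>C x = a *\<^sub>C x + b *\<^sub>C x"
    and scaleC_scaleC: "a *\<^sub>C b *\<^sub>C x = (a * b) *\<^sub>C x"
    and scaleR_scaleC: "c *\<^sub>R x = complex_of_real c *\<^sub>C x"
    and cinner_commute: "cinner x y = cnj (cinner y x)"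
    and cinner_add_left: "cinner (x + y) z = cinner x z + cinner y z"
    and cinner_scaleC_left: "cinner (a *\<^sub>C x) y = a * cinner x y"
    and cinner_self: "cinner x x = complex_of_real ((norm x)\<^sup>2)"

lemma scaleC_one: "1 *\<^sub>C x = x"
  for x :: "'a::complex_hilbert_space"
  using scaleR_scaleC[of 1 x] by simp

lemma cinner_scaleC_right: "cinner x (a *\<^sub>C y) = cnj a * cinner x y"
  for x :: "'a::complex_hilbert_space"
  by (metis cinner_commute cinner_scaleC_left complex_cnj_mult)

lemma norm_scaleC: "norm (a *\<^sub>C x) = cmod a * norm x"
  for x :: "'a::complex_hilbert_space"
proof -
  have "complex_of_real ((norm (a *\<^sub>C x))\<^sup>2) = (a * cnj a) * complex_of_real ((norm x)\<^sup>2)"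
    unfolding cinner_self[symmetric]
    by (simp add: cinner_scaleC_left cinner_scaleC_right)
  also have "\<dots> = complex_of_real ((cmod a * norm x)\<^sup>2)"
    by (simp add: complex_norm_square[symmetric] power_mult_distrib del: of_real_power)
  finally have "(norm (a *\<^sub>C x))\<^sup>2 = (cmod a * norm x)\<^sup>2"
    by (simp only: of_real_eq_iff)
  then show ?thesis
    by (simp add: power2_eq_iff_nonneg)
qed

global_interpretation complex_vector:
    vector_space "scaleC :: complex \<Rightarrow> 'a \<Rightarrow> 'a::complex_hilbert_space"
  defines cspan = complex_vector.span
  by unfold_locales
    (simp_all add: scaleC_add_right scaleC_add_left scaleC_scaleC scaleC_one)

definition orthonormal_basis :: "(nat \<Rightarrow> 'a::complex_hilbert_space) \<Rightarrow> bool" where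
  "orthonormal_basis e \<longleftrightarrow>
     (\<forall>i\<ge>1. \<forall>j\<ge>1. cinner (e i) (e j) = (if i = j then 1 else 0)) \<and>
     closure (cspan (e ` {1..})) = UNIV"

text \<open>
  \<open>'a \<Rightarrow>\<^sub>L 'a\<close> consists of the real-linear bounded operators; \<open>bounded_ops\<close>, that is B(H), are the
  complex-linear ones among them. Norm and composition are those of \<open>'a \<Rightarrow>\<^sub>L 'a\<close>.
\<close>

definition bounded_ops :: "('a::complex_hilbert_space \<Rightarrow>\<^sub>L 'a) set" where
  "bounded_ops = {F. \<forall>c x. blinfun_apply F (c *\<^sub>C x) = c *\<^sub>C blinfun_apply F x}"

lift_definition scaleC_op ::
    "complex \<Rightarrow> ('a::complex_hilbert_space \<Rightarrow>\<^sub>L 'a) \<Rightarrow> ('a \<Rightarrow>\<^sub>L 'a)"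
  is "\<lambda>c F x. c *\<^sub>C F x"
proof -
  fix c :: complex and F :: "'a \<Rightarrow> 'a"
  assume F: "bounded_linear F"
  have "bounded_linear (\<lambda>x::'a. c *\<^sub>C x)"
    by (rule bounded_linear_intro[where K = "cmod c"])
      (simp_all add: scaleC_add_right scaleR_scaleC scaleC_scaleC norm_scaleC mult.commute)
  from bounded_linear_compose[OF this F] show "bounded_linear (\<lambda>x. c *\<^sub>C F x)" .
qed

definition op_pow :: "('a::real_normed_vector \<Rightarrow>\<^sub>L 'a) \<Rightarrow> nat \<Rightarrow> ('a \<Rightarrow>\<^sub>L 'a)" where
  "op_pow F m = ((\<lambda>G. F o\<^sub>L G) ^^ m) id_blinfun"

definition is_op_inverse ::
    "('a::complex_hilbert_space \<Rightarrow>\<^sub>L 'a) \<Rightarrow> ('a \<Rightarrow>\<^sub>L 'a) \<Rightarrow> bool" where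
  "is_op_inverse F G \<longleftrightarrow> G \<in> bounded_ops \<and> F o\<^sub>L G = id_blinfun \<and> G o\<^sub>L F = id_blinfun"

definition invertible_op :: "('a::complex_hilbert_space \<Rightarrow>\<^sub>L 'a) \<Rightarrow> bool" where
  "invertible_op F \<longleftrightarrow> F \<in> bounded_ops \<and> (\<exists>G. is_op_inverse F G)"

definition op_inv :: "('a::complex_hilbert_space \<Rightarrow>\<^sub>L 'a) \<Rightarrow> ('a \<Rightarrow>\<^sub>L 'a)" where
  "op_inv F = (THE G. is_op_inverse F G)"

definition is_adjoint ::
    "('a::complex_hilbert_space \<Rightarrow>\<^sub>L 'a) \<Rightarrow> ('a \<Rightarrow>\<^sub>L 'a) \<Rightarrow> bool" where
  "is_adjoint F G \<longleftrightarrow> G \<in> bounded_ops \<and>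
     (\<forall>x y. cinner (blinfun_apply F x) y = cinner x (blinfun_apply G y))"

definition unitary_op :: "('a::complex_hilbert_space \<Rightarrow>\<^sub>L 'a) \<Rightarrow> bool" where
  "unitary_op U \<longleftrightarrow> U \<in> bounded_ops \<and>
     (\<exists>V. is_adjoint U V \<and> U o\<^sub>L V = id_blinfun \<and> V o\<^sub>L U = id_blinfun)"

definition is_orth_proj ::
    "'a::complex_hilbert_space set \<Rightarrow> ('a \<Rightarrow>\<^sub>L 'a) \<Rightarrow> bool" where
  "is_orth_proj L P \<longleftrightarrow> P \<in> bounded_ops \<and>
     (\<forall>x. blinfun_apply P x \<in> L \<and> (\<forall>y\<in>L. cinner (x - blinfun_apply P x) y = 0))"

definition orth_proj :: "'a::complex_hilbert_space set \<Rightarrow> ('a \<Rightarrow>\<^sub>L 'a)" where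
  "orth_proj L = (THE P. is_orth_proj L P)"

definition basis_proj :: "(nat \<Rightarrow> 'a::complex_hilbert_space) \<Rightarrow> nat \<Rightarrow> ('a \<Rightarrow>\<^sub>L 'a)" where
  "basis_proj e n = orth_proj (cspan (e ` {1..n}))"

definition sot :: "('a::complex_hilbert_space \<Rightarrow>\<^sub>L 'a) topology" where
  "sot = subtopology strong_operator_topology bounded_ops"

text \<open>
  The functionals on B(H) are represented by functions that take the value \<open>undefined\<close> outside of
  \<open>bounded_ops\<close>, so that functionals agreeing on B(H) are equal.
\<close>

definition sot_dual :: "(('a::complex_hilbert_space \<Rightarrow>\<^sub>L 'a) \<Rightarrow> complex) set" where
  "sot_dual = {\<phi> \<in> extensional bounded_ops.
     (\<forall>F\<in>bounded_ops. \<forall>G\<in>bounded_ops. \<phi> (F + G) = \<phi> F + \<phi> G) \<and>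
     (\<forall>c. \<forall>F\<in>bounded_ops. \<phi> (scaleC_op c F) = c * \<phi> F) \<and>
     continuous_map sot euclidean \<phi>}"

text \<open>The weak-star topology is the topology of pointwise convergence on B(H).\<close>

definition weak_star :: "(('a::complex_hilbert_space \<Rightarrow>\<^sub>L 'a) \<Rightarrow> complex) topology" where
  "weak_star = subtopology (product_topology (\<lambda>_. euclidean) bounded_ops) sot_dual"

definition T_op ::
    "('a::complex_hilbert_space \<Rightarrow>\<^sub>L 'a) \<Rightarrow> ('a \<Rightarrow>\<^sub>L 'a) \<Rightarrow> ('a \<Rightarrow>\<^sub>L 'a) \<Rightarrow> ('a \<Rightarrow>\<^sub>L 'a)" where
  "T_op U W F = W o\<^sub>L F o\<^sub>L U"

definition dual_op ::
    "(('a::complex_hilbert_space \<Rightarrow>\<^sub>L 'a) \<Rightarrow> ('a \<Rightarrow>\<^sub>L 'a)) \<Rightarrow>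
     (('a \<Rightarrow>\<^sub>L 'a) \<Rightarrow> complex) \<Rightarrow> (('a \<Rightarrow>\<^sub>L 'a) \<Rightarrow> complex)" where
  "dual_op T \<phi> = restrict (\<lambda>F. \<phi> (T F)) bounded_ops"

text \<open>
  Disjoint topological transitivity of the operators \<open>A 1, \<dots>, A N\<close> on the space \<open>X\<close>. The natural
  number \<open>n\<close> is required to be positive, as natural numbers start from 1 here.
\<close>

definition d_topologically_transitive ::
    "'b topology \<Rightarrow> nat \<Rightarrow> (nat \<Rightarrow> 'b \<Rightarrow> 'b) \<Rightarrow> bool" where
  "d_topologically_transitive X N A \<longleftrightarrow>
     (\<forall>S V. openin X S \<and> S \<noteq> {} \<and> (\<forall>l\<in>{1..N}. openin X (V l) \<and> V l \<noteq> {}) \<longrightarrow>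
        (\<exists>n\<ge>1. S \<inter> (\<Inter>l\<in>{1..N}. {x \<in> topspace X. (A l ^^ n) x \<in> V l}) \<noteq> {}))"

end

theory Submission
  imports Defs
begin

text \<open>
  Let \<open>\<phi>\<close> and \<open>\<psi>\<^sub>1, \<dots>, \<psi>\<^sub>N\<close> be functionals in the given weak-star open sets. The projections
  \<open>P\<^sub>n\<close> converge strongly to the identity, so the functionals \<open>\<phi>(P\<^sub>n F)\<close> and \<open>\<psi>\<^sub>l(P\<^sub>n F)\<close> of \<open>F\<close>
  still lie in these sets when \<open>n\<close> is large. Fix such an \<open>n\<close>, take the sequences of the hypothesis,
  abbreviate \<open>a\<^sub>l = r\<^sub>l n\<^sub>k\<close>, and consider the functionals

  \<open>\<eta>\<^sub>k(F) = \<phi>(D\<^sub>k F) + (\<Sum>s. \<psi>\<^sub>s(G\<^sub>s\<^sub>k W\<^sub>s\<^bsup>-a\<^sub>s\<^esup> F U\<^bsup>-a\<^sub>s\<^esup>))\<close>,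

  where \<open>G\<^sub>s\<^sub>k\<close> is the \<open>k\<close>-th term of the sequence belonging to \<open>s\<close>. Strongly continuous functionals
  are bounded for the operator norm (\<open>sot_dual_norm_bounded\<close>), and powers of \<open>U\<close> and of its inverse
  are contractions. Hence a summand tends to 0 at every \<open>F\<close> as soon as the operator to the left of
  \<open>F\<close> tends to 0 in norm (\<open>sot_dual_null_sequence\<close>), while strong convergence of that operator
  passes through the functional when nothing stands to the right of \<open>F\<close> (\<open>sot_dual_left_tendsto\<close>).

  So \<open>\<eta>\<^sub>k(F)\<close> tends to \<open>\<phi>(P\<^sub>n F)\<close>. The \<open>a\<^sub>l\<close>-th power of the dual operator with index \<open>l\<close> replaces
  \<open>F\<close> by \<open>W\<^sub>l\<^bsup>a\<^sub>l\<^esup> F U\<^bsup>a\<^sub>l\<^esup>\<close>: in the summand \<open>s = l\<close> all powers cancel, leaving \<open>\<psi>\<^sub>l(G\<^sub>l\<^sub>k F)\<close>, which tends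
  to \<open>\<psi>\<^sub>l(P\<^sub>n F)\<close>, and the other summands tend to 0 by the conditions on \<open>D\<^sub>k W\<^sub>l\<^bsup>a\<^sub>l\<^esup>\<close> and
  \<open>G\<^sub>s\<^sub>k W\<^sub>s\<^bsup>-a\<^sub>s\<^esup> W\<^sub>l\<^bsup>a\<^sub>l\<^esup>\<close>. A large \<open>k\<close> therefore gives the required functional \<open>\<eta>\<^sub>k\<close>, with \<open>n\<^sub>k\<close> as the
  number of iterations.
\<close>

section \<open>Bounded complex-linear operators\<close>

lemma bounded_opsD: "F \<in> bounded_ops \<Longrightarrow> blinfun_apply F (c *\<^sub>C x) = c *\<^sub>C blinfun_apply F x"
  by (simp add: bounded_ops_def)

lemma compose_in_bounded_ops:
  "F \<in> bounded_ops \<Longrightarrow> G \<in> bounded_ops \<Longrightarrow> F o\<^sub>L G \<in> bounded_ops"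
  by (simp add: bounded_ops_def)

lemma id_in_bounded_ops: "id_blinfun \<in> bounded_ops"
  by (simp add: bounded_ops_def)

lemma add_in_bounded_ops:
  "F \<in> bounded_ops \<Longrightarrow> G \<in> bounded_ops \<Longrightarrow> F + G \<in> bounded_ops"
  by (simp add: bounded_ops_def blinfun.add_left scaleC_add_right)

lemma scaleC_op_in_bounded_ops: "F \<in> bounded_ops \<Longrightarrow> scaleC_op c F \<in> bounded_ops"
  by (simp add: bounded_ops_def scaleC_op.rep_eq scaleC_scaleC mult.commute)

lemma scaleR_in_bounded_ops: "F \<in> bounded_ops \<Longrightarrow> c *\<^sub>R F \<in> bounded_ops"
  by (simp add: bounded_ops_def blinfun.scaleR_left scaleR_scaleC scaleC_scaleC mult.commute)

lemma scaleR_eq_scaleC_op: "c *\<^sub>R F = scaleC_op (complex_of_real c) F"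
  by (rule blinfun_eqI) (simp add: scaleC_op.rep_eq blinfun.scaleR_left scaleR_scaleC)

lemma compose_id_blinfun [simp]: "F o\<^sub>L id_blinfun = F" "id_blinfun o\<^sub>L F = F"
  by (auto intro: blinfun_eqI)

lemma blinfun_compose_assoc: "(F o\<^sub>L G) o\<^sub>L H = F o\<^sub>L (G o\<^sub>L H)"
  by (rule blinfun_eqI) simp

lemma op_pow_0 [simp]: "op_pow F 0 = id_blinfun"
  by (simp add: op_pow_def)

lemma op_pow_Suc: "op_pow F (Suc m) = F o\<^sub>L op_pow F m"
  by (simp add: op_pow_def)

lemma op_pow_Suc_right: "op_pow F (Suc m) = op_pow F m o\<^sub>L F"
proof (induction m)
  case (Suc m)
  have "op_pow F (Suc (Suc m)) = F o\<^sub>L (op_pow F m o\<^sub>L F)"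
    unfolding op_pow_Suc[of F "Suc m"] Suc ..
  then show ?case
    by (simp add: op_pow_Suc blinfun_compose_assoc)
qed (simp add: op_pow_Suc)

lemma op_pow_in_bounded_ops: "F \<in> bounded_ops \<Longrightarrow> op_pow F m \<in> bounded_ops"
  by (induction m) (simp_all add: id_in_bounded_ops op_pow_Suc compose_in_bounded_ops)

lemma op_pow_left_inverse:
  assumes "G o\<^sub>L F = id_blinfun"
  shows "op_pow G m o\<^sub>L op_pow F m = id_blinfun"
proof (induction m)
  case (Suc m)
  have "op_pow G (Suc m) o\<^sub>L op_pow F (Suc m) = op_pow G m o\<^sub>L (G o\<^sub>L F) o\<^sub>L op_pow F m"
    unfolding op_pow_Suc_right[of G] op_pow_Suc[of F] by (simp add: blinfun_compose_assoc)
  then show ?case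
    using Suc assms by simp
qed simp

lemma norm_op_pow_le_1:
  assumes "norm F \<le> 1"
  shows "norm (op_pow F m) \<le> 1"
proof (induction m)
  case 0
  show ?case
    by (simp add: norm_blinfun_bound)
next
  case (Suc m)
  have "norm (op_pow F (Suc m)) \<le> norm F * norm (op_pow F m)"
    unfolding op_pow_Suc by (rule norm_blinfun_compose)
  also have "\<dots> \<le> 1"
    using mult_mono[OF assms Suc] by simp
  finally show ?case .
qed

lemma is_op_inverse_op_inv:
  assumes "invertible_op F"
  shows "is_op_inverse F (op_inv F)"
proof -
  obtain G where G: "is_op_inverse F G"
    using assms by (auto simp: invertible_op_def)
  moreover have "G' = G" if "is_op_inverse F G'" for G'
  proof -
    have "G' = (G o\<^sub>L F) o\<^sub>L G'"
      using G by (simp add: is_op_inverse_def)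
    also have "\<dots> = G o\<^sub>L (F o\<^sub>L G')"
      by (rule blinfun_compose_assoc)
    finally show ?thesis
      using that by (simp add: is_op_inverse_def)
  qed
  ultimately show ?thesis
    unfolding op_inv_def by (rule theI)
qed

lemma norm_le_1_if_adjoint_left_inverse:
  assumes "is_adjoint F G" and "G o\<^sub>L F = id_blinfun"
  shows "norm F \<le> 1"
proof (rule norm_blinfun_bound)
  fix x
  have "cinner (blinfun_apply F x) (blinfun_apply F x) = cinner x (blinfun_apply (G o\<^sub>L F) x)"
    using assms(1) by (simp add: is_adjoint_def)
  also have "\<dots> = cinner x x"
    by (simp add: assms(2))
  finally have "(norm (blinfun_apply F x))\<^sup>2 = (norm x)\<^sup>2"
    unfolding cinner_self by (simp only: of_real_eq_iff)
  then show "norm (blinfun_apply F x) \<le> 1 * norm x"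
    by (simp add: power2_eq_iff_nonneg)
qed simp

lemma is_adjoint_sym:
  assumes "is_adjoint F G" and "F \<in> bounded_ops"
  shows "is_adjoint G F"
proof -
  have "cinner (blinfun_apply G x) y = cinner x (blinfun_apply F y)" for x y
    using assms(1) cinner_commute[of "blinfun_apply G x" y] cinner_commute[of x "blinfun_apply F y"]
    by (simp add: is_adjoint_def)
  then show ?thesis
    using assms(2) by (simp add: is_adjoint_def)
qed

lemma unitary_op_inverse:
  assumes "unitary_op U"
  obtains V where "V \<in> bounded_ops" "U o\<^sub>L V = id_blinfun" "norm U \<le> 1" "norm V \<le> 1"
proof -
  obtain V where V: "is_adjoint U V" "U o\<^sub>L V = id_blinfun" "V o\<^sub>L U = id_blinfun"
    and U: "U \<in> bounded_ops"
    using assms by (auto simp: unitary_op_def)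
  show ?thesis
  proof (rule that[of V])
    show "V \<in> bounded_ops"
      using V(1) by (simp add: is_adjoint_def)
    show "norm U \<le> 1"
      by (rule norm_le_1_if_adjoint_left_inverse[OF V(1,3)])
    show "norm V \<le> 1"
      by (rule norm_le_1_if_adjoint_left_inverse[OF is_adjoint_sym[OF V(1) U] V(2)])
  qed (fact V(2))
qed

section \<open>Orthogonal projections onto the spans of the basis\<close>

lemma cinner_zero_left [simp]: "cinner 0 z = 0"
  using cinner_add_left[of 0 0 z] by simp

lemma cinner_diff_left: "cinner (x - y) z = cinner x z - cinner y z"
  using cinner_add_left[of "x - y" y z] by simp

lemma cinner_add_right: "cinner z (x + y) = cinner z x + cinner z y"
  unfolding cinner_commute[of z] by (simp add: cinner_add_left)

lemma cinner_zero_right [simp]: "cinner z 0 = 0"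
  using cinner_add_right[of z 0 0] by simp

lemma cinner_sum_left: "cinner (\<Sum>i\<in>I. f i) z = (\<Sum>i\<in>I. cinner (f i) z)"
  by (induction I rule: infinite_finite_induct) (simp_all add: cinner_add_left)

lemma cinner_self_eq_0D: "cinner x x = 0 \<Longrightarrow> x = 0"
  by (simp add: cinner_self)

lemma norm_le_if_residual_orthogonal:
  assumes "cinner (x - y) y = 0"
  shows "norm y \<le> norm x"
proof -
  have sym: "cinner y (x - y) = 0"
    using assms cinner_commute[of y "x - y"] by simp
  have "cinner x x = cinner ((x - y) + y) ((x - y) + y)"
    by simp
  also have "\<dots> = cinner (x - y) (x - y) + cinner y y"
    unfolding cinner_add_left cinner_add_right assms sym by simp
  finally have "complex_of_real ((norm x)\<^sup>2) = complex_of_real ((norm (x - y))\<^sup>2 + (norm y)\<^sup>2)"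
    unfolding cinner_self of_real_add .
  then have "(norm x)\<^sup>2 = (norm (x - y))\<^sup>2 + (norm y)\<^sup>2"
    by (simp only: of_real_eq_iff)
  then have "(norm y)\<^sup>2 \<le> (norm x)\<^sup>2"
    by simp
  then show ?thesis
    by (rule power2_le_imp_le) simp
qed

lemma is_orth_proj_unique:
  assumes "is_orth_proj (cspan S) P" and "is_orth_proj (cspan S) Q"
  shows "P = Q"
proof (rule blinfun_eqI)
  fix x
  let ?d = "blinfun_apply P x - blinfun_apply Q x"
  have "?d \<in> cspan S"
    using assms by (auto simp: is_orth_proj_def intro: complex_vector.span_diff)
  then have "cinner (x - blinfun_apply Q x) ?d = 0" "cinner (x - blinfun_apply P x) ?d = 0"
    using assms by (auto simp: is_orth_proj_def)
  then have "cinner ?d ?d = 0"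
    by (simp add: cinner_diff_left)
  then show "blinfun_apply P x = blinfun_apply Q x"
    using cinner_self_eq_0D by fastforce
qed

lemma is_orth_proj_span_orthonormal:
  assumes fin: "finite I"
    and on: "\<And>i j. i \<in> I \<Longrightarrow> j \<in> I \<Longrightarrow> cinner (e i) (e j) = (if i = j then 1 else 0)"
  shows "\<exists>P. is_orth_proj (cspan (e ` I)) P"
proof -
  define p where "p x = (\<Sum>i\<in>I. cinner x (e i) *\<^sub>C e i)" for x
  have p_span: "p x \<in> cspan (e ` I)" for x
    unfolding p_def
    by (intro complex_vector.span_sum complex_vector.span_scale complex_vector.span_base) auto
  have p_coeff: "cinner (p x) (e j) = cinner x (e j)" if "j \<in> I" for x j
  proof -
    have "cinner (p x) (e j) = (\<Sum>i\<in>I. if i = j then cinner x (e i) else 0)"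
      unfolding p_def cinner_sum_left
      by (rule sum.cong) (use on that in \<open>auto simp: cinner_scaleC_left\<close>)
    then show ?thesis
      using fin that by simp
  qed
  have p_orth: "cinner (x - p x) y = 0" if "y \<in> cspan (e ` I)" for x y
    using that
  proof (induction rule: complex_vector.span_induct_alt)
    case base
    show ?case by simp
  next
    case (step c b y)
    then show ?case
      using p_coeff by (auto simp: cinner_add_right cinner_scaleC_right cinner_diff_left)
  qed
  have p_scaleC: "p (c *\<^sub>C x) = c *\<^sub>C p x" for c x
    unfolding p_def
    by (simp add: cinner_scaleC_left complex_vector.scale_sum_right scaleC_scaleC)
  have "bounded_linear p"
  proof (rule bounded_linear_intro[where K = 1])
    show "p (x + y) = p x + p y" for x y
      unfolding p_def by (simp add: cinner_add_left scaleC_add_left sum.distrib)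
    show "p (c *\<^sub>R x) = c *\<^sub>R p x" for c x
      by (simp add: scaleR_scaleC p_scaleC)
    show "norm (p x) \<le> norm x * 1" for x
      using norm_le_if_residual_orthogonal[OF p_orth[OF p_span]] by simp
  qed
  then have "is_orth_proj (cspan (e ` I)) (Blinfun p)"
    by (simp add: is_orth_proj_def bounded_ops_def bounded_linear_Blinfun_apply
        p_scaleC p_span p_orth)
  then show ?thesis ..
qed

lemma is_orth_proj_basis_proj:
  assumes "orthonormal_basis e"
  shows "is_orth_proj (cspan (e ` {1..n})) (basis_proj e n)"
proof -
  obtain P where P: "is_orth_proj (cspan (e ` {1..n})) P"
    using is_orth_proj_span_orthonormal[of "{1..n}" e] assms
    by (auto simp: orthonormal_basis_def)
  then show ?thesis
    unfolding basis_proj_def orth_proj_def by (rule theI) (rule is_orth_proj_unique[OF _ P])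
qed

lemma basis_proj_in_bounded_ops: "orthonormal_basis e \<Longrightarrow> basis_proj e n \<in> bounded_ops"
  using is_orth_proj_basis_proj by (auto simp: is_orth_proj_def)

lemma is_orth_proj_fixes:
  assumes "is_orth_proj (cspan S) P" and "y \<in> cspan S"
  shows "blinfun_apply P y = y"
proof -
  have "y - blinfun_apply P y \<in> cspan S"
    using assms by (auto simp: is_orth_proj_def intro: complex_vector.span_diff)
  then have "cinner (y - blinfun_apply P y) (y - blinfun_apply P y) = 0"
    using assms(1) by (auto simp: is_orth_proj_def)
  then show ?thesis
    using cinner_self_eq_0D by fastforce
qed

lemma is_orth_proj_norm_le: "is_orth_proj L P \<Longrightarrow> norm (blinfun_apply P x) \<le> norm x"
  by (auto simp: is_orth_proj_def intro: norm_le_if_residual_orthogonal)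

text \<open>
  Strong convergence of the basis projections to the identity: the projections are contractions,
  so convergence need only be checked on the dense span of the basis, where the sequence is
  eventually constant.
\<close>

lemma basis_proj_tendsto:
  assumes "orthonormal_basis e"
  shows "(\<lambda>n. blinfun_apply (basis_proj e n) x) \<longlonglongrightarrow> x"
proof (rule LIMSEQ_I)
  fix \<epsilon> :: real
  assume "0 < \<epsilon>"
  have "x \<in> closure (cspan (e ` {1..}))"
    using assms by (simp add: orthonormal_basis_def)
  then obtain y where y: "y \<in> cspan (e ` {1..})" "dist y x < \<epsilon> / 2"
    using \<open>0 < \<epsilon>\<close> by (metis closure_approachable half_gt_zero)
  obtain T where T: "finite T" "T \<subseteq> e ` {1..}" "y \<in> cspan T"
  proof -
    obtain T c where "finite T" "T \<subseteq> e ` {1..}" "y = (\<Sum>v\<in>T. c v *\<^sub>C v)"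
      using y(1) unfolding complex_vector.span_explicit by blast
    then show ?thesis
      by (intro that) (auto intro: complex_vector.span_sum complex_vector.span_scale
          complex_vector.span_base)
  qed
  obtain I where I: "finite I" "I \<subseteq> {1..}" "T = e ` I"
    using T by (meson finite_subset_image)
  obtain n0 where n0: "I \<subseteq> {..n0}"
    using I(1) finite_nat_iff_bounded_le by auto
  have "norm (blinfun_apply (basis_proj e n) x - x) < \<epsilon>" if "n \<ge> n0" for n
  proof -
    let ?P = "basis_proj e n"
    have proj: "is_orth_proj (cspan (e ` {1..n})) ?P"
      by (rule is_orth_proj_basis_proj[OF assms])
    have "T \<subseteq> e ` {1..n}"
      using I n0 that by fastforce
    then have "y \<in> cspan (e ` {1..n})"
      using T(3) complex_vector.span_mono by blast
    then have "blinfun_apply ?P y = y"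
      by (rule is_orth_proj_fixes[OF proj])
    then have "blinfun_apply ?P x - x = blinfun_apply ?P (x - y) + (y - x)"
      by (simp add: blinfun.diff_right)
    then have "norm (blinfun_apply ?P x - x) \<le> norm (blinfun_apply ?P (x - y)) + norm (y - x)"
      by (simp only: norm_triangle_ineq)
    also have "\<dots> \<le> norm (x - y) + norm (y - x)"
      using is_orth_proj_norm_le[OF proj] by simp
    also have "\<dots> < \<epsilon>"
      using y(2) by (simp add: dist_norm norm_minus_commute)
    finally show ?thesis .
  qed
  then show "\<exists>n0. \<forall>n\<ge>n0. norm (blinfun_apply (basis_proj e n) x - x) < \<epsilon>"
    by blast
qed

section \<open>The strong operator topology and its dual\<close>

lemma topspace_sot [simp]: "topspace sot = bounded_ops"
  by (simp add: sot_def strong_operator_topology_topspace)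

lemma continuous_map_sot_apply: "continuous_map sot euclidean (\<lambda>F. blinfun_apply F x)"
  unfolding sot_def
  by (intro continuous_map_from_subtopology strong_operator_topology_continuous_evaluation)

lemma continuous_map_into_sot_iff:
  "continuous_map X sot f \<longleftrightarrow>
     f \<in> topspace X \<rightarrow> bounded_ops \<and> (\<forall>x. continuous_map X euclidean (\<lambda>t. blinfun_apply (f t) x))"
  unfolding sot_def continuous_map_in_subtopology
    continuous_on_strong_operator_topo_iff_coordinatewise by auto

lemma limitin_sot_iff:
  assumes "\<And>k. A k \<in> bounded_ops"
  shows "limitin sot A L sequentially \<longleftrightarrow>
     L \<in> bounded_ops \<and> (\<forall>x. (\<lambda>k. blinfun_apply (A k) x) \<longlonglongrightarrow> blinfun_apply L x)"
proof
  assume lim: "limitin sot A L sequentially"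
  then have "L \<in> bounded_ops"
    using limitin_topspace by fastforce
  moreover have "(\<lambda>k. blinfun_apply (A k) x) \<longlonglongrightarrow> blinfun_apply L x" for x
    using continuous_map_limit[OF continuous_map_sot_apply lim] by (simp add: o_def)
  ultimately show "L \<in> bounded_ops \<and> (\<forall>x. (\<lambda>k. blinfun_apply (A k) x) \<longlonglongrightarrow> blinfun_apply L x)"
    by blast
next
  assume R: "L \<in> bounded_ops \<and> (\<forall>x. (\<lambda>k. blinfun_apply (A k) x) \<longlonglongrightarrow> blinfun_apply L x)"
  have "(\<lambda>k. blinfun_apply (A k)) \<longlonglongrightarrow> blinfun_apply L"
    using R unfolding limitin_canonical_iff[symmetric] euclidean_product_topology[symmetric]
      limitin_componentwise by simp
  show "limitin sot A L sequentially"
    unfolding sot_def limitin_subtopology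
  proof (intro conjI always_eventually allI)
    show "limitin strong_operator_topology A L sequentially"
      unfolding limitin_def
    proof (intro conjI allI impI)
      fix O'
      assume "openin strong_operator_topology O' \<and> L \<in> O'"
      then obtain T where T: "open T" "O' = blinfun_apply -` T" "L \<in> O'"
        unfolding strong_operator_topology_def openin_pullback_topology by auto
      then have "\<forall>\<^sub>F k in sequentially. blinfun_apply (A k) \<in> T"
        using \<open>(\<lambda>k. blinfun_apply (A k)) \<longlonglongrightarrow> blinfun_apply L\<close> topological_tendstoD by blast
      then show "\<forall>\<^sub>F k in sequentially. A k \<in> O'"
        using T(2) by simp
    qed (simp add: strong_operator_topology_topspace)
  qed (use R assms in auto)
qed

lemma sot_dual_add:
  "\<phi> \<in> sot_dual \<Longrightarrow> F \<in> bounded_ops \<Longrightarrow> G \<in> bounded_ops \<Longrightarrow> \<phi> (F + G) = \<phi> F + \<phi> G"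
  by (simp add: sot_dual_def)

lemma sot_dual_scale:
  "\<phi> \<in> sot_dual \<Longrightarrow> F \<in> bounded_ops \<Longrightarrow> \<phi> (scaleC_op c F) = c * \<phi> F"
  by (simp add: sot_dual_def)

lemma sot_dual_continuous: "\<phi> \<in> sot_dual \<Longrightarrow> continuous_map sot euclidean \<phi>"
  by (simp add: sot_dual_def)

lemma sot_dual_extensional: "\<phi> \<in> sot_dual \<Longrightarrow> \<phi> \<in> extensional bounded_ops"
  by (simp add: sot_dual_def)

text \<open>
  The strong operator topology is coarser than the norm topology, so its continuous functionals
  are bounded for the operator norm.
\<close>

lemma sot_dual_norm_bounded:
  assumes \<phi>: "\<phi> \<in> sot_dual"
  obtains C where "\<And>F. F \<in> bounded_ops \<Longrightarrow> cmod (\<phi> F) \<le> C * norm F"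
proof -
  have zero: "(0 :: 'a \<Rightarrow>\<^sub>L 'a) \<in> bounded_ops"
    by (simp add: bounded_ops_def)
  have \<phi>0: "\<phi> 0 = 0"
    using sot_dual_add[OF \<phi> zero zero] by simp
  have "openin sot {F \<in> topspace sot. \<phi> F \<in> ball 0 1}"
    by (rule openin_continuous_map_preimage[OF sot_dual_continuous[OF \<phi>]]) simp
  then obtain T where T: "openin strong_operator_topology T"
      "{F \<in> bounded_ops. \<phi> F \<in> ball 0 1} = T \<inter> bounded_ops"
    unfolding topspace_sot unfolding sot_def openin_subtopology by auto
  have "open T"
    using T(1) strong_operator_topology_weaker_than_euclidean
    by (auto simp: continuous_map_def)
  moreover have "0 \<in> T"
  proof -
    have "0 \<in> {F \<in> bounded_ops. \<phi> F \<in> ball 0 1}"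
      using zero \<phi>0 by simp
    then show ?thesis
      unfolding T(2) by blast
  qed
  ultimately obtain d where d: "0 < d" "ball 0 d \<subseteq> T"
    by (meson openE)
  have small: "cmod (\<phi> F) < 1" if "F \<in> bounded_ops" "norm F < d" for F
  proof -
    have "F \<in> T \<inter> bounded_ops"
      using that d(2) by auto
    then show ?thesis
      unfolding T(2)[symmetric] by simp
  qed
  have "cmod (\<phi> F) \<le> (2 / d) * norm F" if F: "F \<in> bounded_ops" for F
  proof (cases "F = 0")
    case True
    then show ?thesis by (simp add: \<phi>0)
  next
    case False
    define c where "c = d / (2 * norm F)"
    have c: "0 < c"
      using d(1) False by (simp add: c_def)
    have "norm (c *\<^sub>R F) < d"
      using d(1) False by (simp add: c_def)
    then have "cmod (\<phi> (c *\<^sub>R F)) < 1"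
      by (intro small scaleR_in_bounded_ops F)
    then have "c * cmod (\<phi> F) < 1"
      using c by (simp add: scaleR_eq_scaleC_op sot_dual_scale[OF \<phi> F] norm_mult)
    then show ?thesis
      using d(1) False by (simp add: c_def field_simps)
  qed
  then show ?thesis
    using that by blast
qed

lemma continuous_map_sot_T_op:
  assumes "A \<in> bounded_ops" "B \<in> bounded_ops"
  shows "continuous_map sot sot (T_op B A)"
  unfolding continuous_map_into_sot_iff
proof (intro conjI allI)
  show "T_op B A \<in> topspace sot \<rightarrow> bounded_ops"
    using assms by (auto simp: T_op_def compose_in_bounded_ops)
next
  fix x
  have "continuous_map sot euclidean (blinfun_apply A \<circ> (\<lambda>F. blinfun_apply F (blinfun_apply B x)))"
    by (rule continuous_map_compose[OF continuous_map_sot_apply])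
      (simp add: blinfun.continuous_on continuous_on_id)
  then show "continuous_map sot euclidean (\<lambda>F. blinfun_apply (T_op B A F) x)"
    by (simp add: T_op_def o_def)
qed

lemma T_op_in_bounded_ops:
  "A \<in> bounded_ops \<Longrightarrow> B \<in> bounded_ops \<Longrightarrow> F \<in> bounded_ops \<Longrightarrow> T_op B A F \<in> bounded_ops"
  by (simp add: T_op_def compose_in_bounded_ops)

lemma dual_op_apply: "F \<in> bounded_ops \<Longrightarrow> dual_op T \<phi> F = \<phi> (T F)"
  by (simp add: dual_op_def)

lemma dual_op_in_extensional: "dual_op T \<phi> \<in> extensional bounded_ops"
  by (simp add: dual_op_def)

text \<open>
  For bounded operators \<open>A\<close> and \<open>B\<close>, \<open>dual_op (T_op B A) \<phi>\<close> is the functional \<open>F \<mapsto> \<phi>(A F B)\<close>. The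
  functionals constructed below are all of this form or sums of such functionals.
\<close>

lemma dual_op_T_op_in_sot_dual:
  assumes A: "A \<in> bounded_ops" and B: "B \<in> bounded_ops" and \<phi>: "\<phi> \<in> sot_dual"
  shows "dual_op (T_op B A) \<phi> \<in> sot_dual"
proof -
  have add: "T_op B A (F + G) = T_op B A F + T_op B A G" for F G
    by (rule blinfun_eqI) (simp add: T_op_def blinfun.add_left blinfun.add_right)
  have scale: "T_op B A (scaleC_op c F) = scaleC_op c (T_op B A F)" for c F
    by (rule blinfun_eqI) (simp add: T_op_def scaleC_op.rep_eq bounded_opsD[OF A])
  have "continuous_map sot euclidean (\<phi> \<circ> T_op B A)"
    by (rule continuous_map_compose[OF continuous_map_sot_T_op[OF A B] sot_dual_continuous[OF \<phi>]])
  then have "continuous_map sot euclidean (dual_op (T_op B A) \<phi>)"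
    by (rule continuous_map_eq) (simp add: dual_op_def)
  moreover have "dual_op (T_op B A) \<phi> \<in> extensional bounded_ops"
    by (rule dual_op_in_extensional)
  ultimately show ?thesis
    unfolding sot_dual_def
    by (auto simp: dual_op_apply add_in_bounded_ops scaleC_op_in_bounded_ops add scale
        sot_dual_add[OF \<phi>] sot_dual_scale[OF \<phi>] T_op_in_bounded_ops A B)
qed

lemma sum_in_sot_dual:
  assumes "finite I" and "\<phi> \<in> sot_dual" and "\<And>i. i \<in> I \<Longrightarrow> \<psi> i \<in> sot_dual"
  shows "restrict (\<lambda>F. \<phi> F + (\<Sum>i\<in>I. \<psi> i F)) bounded_ops \<in> sot_dual"
proof -
  let ?\<eta> = "restrict (\<lambda>F. \<phi> F + (\<Sum>i\<in>I. \<psi> i F)) bounded_ops"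
  have "continuous_map sot euclidean (\<lambda>F. \<phi> F + (\<Sum>i\<in>I. \<psi> i F))"
    using assms by (intro continuous_map_add continuous_map_sum sot_dual_continuous)
  then have "continuous_map sot euclidean ?\<eta>"
    by (rule continuous_map_eq) simp
  moreover have "?\<eta> (F + G) = ?\<eta> F + ?\<eta> G" if "F \<in> bounded_ops" "G \<in> bounded_ops" for F G
    using that assms
    by (simp add: add_in_bounded_ops sot_dual_add sum.distrib)
  moreover have "?\<eta> (scaleC_op c F) = c * ?\<eta> F" if "F \<in> bounded_ops" for c F
    using that assms
    by (simp add: scaleC_op_in_bounded_ops sot_dual_scale distrib_left sum_distrib_left)
  ultimately show ?thesis
    unfolding sot_dual_def by blast
qed

lemma dual_op_T_op_pow:
  assumes W: "W \<in> bounded_ops" and U: "U \<in> bounded_ops" and \<phi>: "\<phi> \<in> extensional bounded_ops"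
  shows "(dual_op (T_op U W) ^^ m) \<phi> = dual_op (T_op (op_pow U m) (op_pow W m)) \<phi>"
proof (induction m)
  case 0
  show ?case
    using \<phi> by (simp add: dual_op_def T_op_def extensional_restrict)
next
  case (Suc m)
  show ?case
  proof (rule extensionalityI[of _ bounded_ops])
    fix F :: "'a \<Rightarrow>\<^sub>L 'a"
    assume F: "F \<in> bounded_ops"
    have "T_op (op_pow U m) (op_pow W m) (T_op U W F) = T_op (op_pow U (Suc m)) (op_pow W (Suc m)) F"
      unfolding op_pow_Suc[of U] op_pow_Suc_right[of W]
      by (simp add: T_op_def blinfun_compose_assoc)
    then show "(dual_op (T_op U W) ^^ Suc m) \<phi> F
        = dual_op (T_op (op_pow U (Suc m)) (op_pow W (Suc m))) \<phi> F"
      using F W U by (simp add: Suc dual_op_apply T_op_in_bounded_ops)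
  qed (simp_all add: dual_op_in_extensional)
qed

lemma topspace_weak_star [simp]: "topspace weak_star = sot_dual"
  by (auto simp: weak_star_def sot_dual_def PiE_def)

lemma limitin_weak_starI:
  assumes "\<And>k. \<eta> k \<in> sot_dual" and "\<phi> \<in> sot_dual"
    and "\<And>F. F \<in> bounded_ops \<Longrightarrow> (\<lambda>k. \<eta> k F) \<longlonglongrightarrow> \<phi> F"
  shows "limitin weak_star \<eta> \<phi> sequentially"
  unfolding weak_star_def limitin_subtopology limitin_componentwise
  using assms by (auto simp: sot_dual_extensional PiE_def)

section \<open>Two limits of functionals\<close>

lemma sot_dual_left_tendsto:
  assumes \<phi>: "\<phi> \<in> sot_dual" and A: "\<And>k. A k \<in> bounded_ops"
    and lim: "limitin sot A L sequentially" and F: "F \<in> bounded_ops"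
  shows "(\<lambda>k. \<phi> (A k o\<^sub>L F)) \<longlonglongrightarrow> \<phi> (L o\<^sub>L F)"
proof -
  have "limitin sot (\<lambda>k. A k o\<^sub>L F) (L o\<^sub>L F) sequentially"
    using lim A F by (simp add: limitin_sot_iff compose_in_bounded_ops)
  then show ?thesis
    using continuous_map_limit[OF sot_dual_continuous[OF \<phi>]] by (fastforce simp: o_def)
qed

lemma sot_dual_null_sequence:
  assumes \<phi>: "\<phi> \<in> sot_dual" and A: "\<And>k. A k \<in> bounded_ops" and X: "\<And>k. X k \<in> bounded_ops"
    and lim: "(\<lambda>k. norm (A k)) \<longlonglongrightarrow> 0" and bd: "\<And>k. norm (X k) \<le> c"
  shows "(\<lambda>k. \<phi> (A k o\<^sub>L X k)) \<longlonglongrightarrow> 0"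
proof -
  obtain C where C: "\<And>F. F \<in> bounded_ops \<Longrightarrow> cmod (\<phi> F) \<le> C * norm F"
    using sot_dual_norm_bounded[OF \<phi>] by blast
  have "norm (\<phi> (A k o\<^sub>L X k)) \<le> \<bar>C\<bar> * c * norm (A k)" for k
  proof -
    have "cmod (\<phi> (A k o\<^sub>L X k)) \<le> C * norm (A k o\<^sub>L X k)"
      by (intro C compose_in_bounded_ops A X)
    also have "\<dots> \<le> \<bar>C\<bar> * (norm (A k) * c)"
      by (intro mult_mono order.trans[OF norm_blinfun_compose] mult_left_mono bd) auto
    finally show ?thesis
      by (simp add: mult_ac)
  qed
  then show ?thesis
    by (intro Lim_null_comparison[OF always_eventually tendsto_mult_right_zero[OF lim]]) blast
qed

lemma dual_op_basis_proj_tendsto: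
  assumes e: "orthonormal_basis e" and \<phi>: "\<phi> \<in> sot_dual"
  shows "limitin weak_star (\<lambda>n. dual_op (T_op id_blinfun (basis_proj e n)) \<phi>) \<phi> sequentially"
proof (rule limitin_weak_starI)
  fix F :: "'a \<Rightarrow>\<^sub>L 'a"
  assume F: "F \<in> bounded_ops"
  have "limitin sot (basis_proj e) id_blinfun sequentially"
    using basis_proj_in_bounded_ops[OF e] basis_proj_tendsto[OF e]
    by (simp add: limitin_sot_iff id_in_bounded_ops)
  from sot_dual_left_tendsto[OF \<phi> basis_proj_in_bounded_ops[OF e] this F]
  show "(\<lambda>n. dual_op (T_op id_blinfun (basis_proj e n)) \<phi> F) \<longlonglongrightarrow> \<phi> F"
    using F by (simp add: dual_op_apply T_op_def)
qed (use e \<phi> in \<open>simp_all add: dual_op_T_op_in_sot_dual basis_proj_in_bounded_ops id_in_bounded_ops\<close>)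

section \<open>Disjoint transitivity\<close>

theorem proposition2p17:
  fixes e :: "nat \<Rightarrow> 'h::complex_hilbert_space"
    and U :: "'h \<Rightarrow>\<^sub>L 'h"
    and W :: "nat \<Rightarrow> 'h \<Rightarrow>\<^sub>L 'h"
    and N :: nat
    and r :: "nat \<Rightarrow> nat"
  assumes basis: "orthonormal_basis e"
    and N: "N \<ge> 2"
    and W: "\<forall>l\<in>{1..N}. invertible_op (W l)"
    and U: "unitary_op U"
    and r_pos: "0 < r 1"
    and r_mono: "strict_mono_on {1..N} r"
    and ii: "\<forall>n\<ge>1. \<exists>(D :: nat \<Rightarrow> 'h \<Rightarrow>\<^sub>L 'h) (G :: nat \<Rightarrow> nat \<Rightarrow> 'h \<Rightarrow>\<^sub>L 'h) (nk :: nat \<Rightarrow> nat).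
      (\<forall>k. D k \<in> bounded_ops) \<and>
      (\<forall>l\<in>{1..N}. \<forall>k. G l k \<in> bounded_ops) \<and>
      strict_mono nk \<and> (\<forall>k. nk k \<ge> 1) \<and>
      limitin sot D (basis_proj e n) sequentially \<and>
      (\<forall>l\<in>{1..N}. limitin sot (G l) (basis_proj e n) sequentially) \<and>
      (\<forall>l\<in>{1..N}.
         (\<lambda>k. norm (D k o\<^sub>L op_pow (W l) (r l * nk k))) \<longlonglongrightarrow> 0 \<and>
         (\<lambda>k. norm (G l k o\<^sub>L op_pow (op_inv (W l)) (r l * nk k))) \<longlonglongrightarrow> 0) \<and>
      (\<forall>s\<in>{1..N}. \<forall>l\<in>{1..N}. s \<noteq> l \<longrightarrow>
         (\<lambda>k. norm (G s k o\<^sub>L op_pow (op_inv (W s)) (r s * nk k)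
                    o\<^sub>L op_pow (W l) (r l * nk k))) \<longlonglongrightarrow> 0)"
  shows "d_topologically_transitive weak_star N
           (\<lambda>l. dual_op (T_op U (W l)) ^^ r l)"
proof -
  let ?P = "basis_proj e"
  have P_bdd: "?P n \<in> bounded_ops" for n
    by (rule basis_proj_in_bounded_ops[OF basis])
  have U_bdd: "U \<in> bounded_ops"
    using U by (simp add: unitary_op_def)
  obtain V where V_bdd: "V \<in> bounded_ops" and UV: "U o\<^sub>L V = id_blinfun"
    and norm_UV: "norm U \<le> 1" "norm V \<le> 1"
    using unitary_op_inverse[OF U] .
  have W_bdd: "W l \<in> bounded_ops" if "l \<in> {1..N}" for l
    using W that by (simp add: invertible_op_def)
  have W_inv: "op_inv (W l) \<in> bounded_ops" "op_inv (W l) o\<^sub>L W l = id_blinfun"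
    if "l \<in> {1..N}" for l
    using is_op_inverse_op_inv[of "W l"] W that by (simp_all add: is_op_inverse_def)
  note bdd = compose_in_bounded_ops op_pow_in_bounded_ops U_bdd V_bdd W_bdd W_inv(1)
  show ?thesis
    unfolding d_topologically_transitive_def
  proof (intro allI impI, elim conjE)
    fix S :: "(('h \<Rightarrow>\<^sub>L 'h) \<Rightarrow> complex) set" and O' :: "nat \<Rightarrow> (('h \<Rightarrow>\<^sub>L 'h) \<Rightarrow> complex) set"
    assume S: "openin weak_star S" "S \<noteq> {}"
      and O': "\<forall>l\<in>{1..N}. openin weak_star (O' l) \<and> O' l \<noteq> {}"
    obtain \<phi> where \<phi>S: "\<phi> \<in> S"
      using S(2) by blast
    have "\<exists>\<psi>. \<forall>l\<in>{1..N}. \<psi> l \<in> O' l"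
      using O' by (intro bchoice) blast
    then obtain \<psi> where \<psi>O: "\<And>l. l \<in> {1..N} \<Longrightarrow> \<psi> l \<in> O' l"
      by blast
    have \<phi>: "\<phi> \<in> sot_dual"
      using \<phi>S openin_subset[OF S(1)] by auto
    have \<psi>: "\<psi> l \<in> sot_dual" if "l \<in> {1..N}" for l
      using \<psi>O[OF that] openin_subset O' that by fastforce
    define \<phi>P where "\<phi>P n = dual_op (T_op id_blinfun (?P n)) \<phi>" for n
    define \<psi>P where "\<psi>P l n = dual_op (T_op id_blinfun (?P n)) (\<psi> l)" for l n
    \<comment> \<open>A large \<open>n\<close> makes the functionals precomposed with \<open>P\<^sub>n\<close> lie in the given open sets.\<close>
    have "\<forall>\<^sub>F n in sequentially. \<phi>P n \<in> S"
      using dual_op_basis_proj_tendsto[OF basis \<phi>] S(1) \<phi>S by (simp add: limitin_def \<phi>P_def)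
    moreover have "\<forall>\<^sub>F n in sequentially. \<forall>l\<in>{1..N}. \<psi>P l n \<in> O' l"
      using dual_op_basis_proj_tendsto[OF basis \<psi>] O' \<psi>O
      by (intro eventually_ball_finite) (auto simp: limitin_def \<psi>P_def)
    ultimately have "\<forall>\<^sub>F n in sequentially. n \<ge> 1 \<and> \<phi>P n \<in> S \<and> (\<forall>l\<in>{1..N}. \<psi>P l n \<in> O' l)"
      using eventually_ge_at_top[of 1] by eventually_elim blast
    then obtain n where n: "n \<ge> 1" and \<phi>PS: "\<phi>P n \<in> S"
      and \<psi>PO: "\<And>l. l \<in> {1..N} \<Longrightarrow> \<psi>P l n \<in> O' l"
      using eventually_happens'[OF sequentially_bot] by blast
    obtain D G nk where ops: "\<forall>k. D k \<in> bounded_ops" "\<forall>l\<in>{1..N}. \<forall>k. G l k \<in> bounded_ops"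
      and pos: "\<forall>k. nk k \<ge> 1"
      and D_lim: "limitin sot D (?P n) sequentially"
      and G_lims: "\<forall>l\<in>{1..N}. limitin sot (G l) (?P n) sequentially"
      and null: "\<forall>l\<in>{1..N}.
        (\<lambda>k. norm (D k o\<^sub>L op_pow (W l) (r l * nk k))) \<longlonglongrightarrow> 0 \<and>
        (\<lambda>k. norm (G l k o\<^sub>L op_pow (op_inv (W l)) (r l * nk k))) \<longlonglongrightarrow> 0"
      and mixed: "\<forall>s\<in>{1..N}. \<forall>l\<in>{1..N}. s \<noteq> l \<longrightarrow>
        (\<lambda>k. norm (G s k o\<^sub>L op_pow (op_inv (W s)) (r s * nk k)
              o\<^sub>L op_pow (W l) (r l * nk k))) \<longlonglongrightarrow> 0"
      using ii[THEN spec, THEN mp, OF n] by (elim exE conjE) (rule that; assumption)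
    note D = ops(1)[rule_format] and G = ops(2)[rule_format] and nk = pos[rule_format]
      and G_lim = G_lims[rule_format] and DW = null[rule_format, THEN conjunct1]
      and GW = null[rule_format, THEN conjunct2] and GWW = mixed[rule_format]
    define a where "a l k = r l * nk k" for l k
    define E where "E l k = G l k o\<^sub>L op_pow (op_inv (W l)) (a l k)" for l k
    have E: "E l k \<in> bounded_ops" if "l \<in> {1..N}" for l k
      using that by (simp add: E_def bdd G)
    define \<eta> where "\<eta> k = restrict (\<lambda>F. dual_op (T_op id_blinfun (D k)) \<phi> F
        + (\<Sum>s\<in>{1..N}. dual_op (T_op (op_pow V (a s k)) (E s k)) (\<psi> s) F)) bounded_ops" for k
    have \<eta>_dual: "\<eta> k \<in> sot_dual" for k
      unfolding \<eta>_def
      by (intro sum_in_sot_dual dual_op_T_op_in_sot_dual) (simp_all add: D E \<phi> \<psi> bdd id_in_bounded_ops)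
    have \<eta>_apply: "\<eta> k F = \<phi> (D k o\<^sub>L F) + (\<Sum>s\<in>{1..N}. \<psi> s (E s k o\<^sub>L (F o\<^sub>L op_pow V (a s k))))"
      if "F \<in> bounded_ops" for k F
      using that by (simp add: \<eta>_def dual_op_apply T_op_def blinfun_compose_assoc)
    have norm_pow_V: "norm (F o\<^sub>L op_pow V m) \<le> norm F" for F m
      using order.trans[OF norm_blinfun_compose mult_left_mono[OF norm_op_pow_le_1[OF norm_UV(2)]]]
      by simp
    have norm_pow_U: "norm (F o\<^sub>L op_pow U m) \<le> norm F" for F m
      using order.trans[OF norm_blinfun_compose mult_left_mono[OF norm_op_pow_le_1[OF norm_UV(1)]]]
      by simp
    have \<eta>_lim: "limitin weak_star \<eta> (\<phi>P n) sequentially"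
    proof (rule limitin_weak_starI)
      fix F :: "'h \<Rightarrow>\<^sub>L 'h"
      assume F: "F \<in> bounded_ops"
      have "(\<lambda>k. \<phi> (D k o\<^sub>L F)) \<longlonglongrightarrow> \<phi> (?P n o\<^sub>L F)"
        by (rule sot_dual_left_tendsto[OF \<phi> D D_lim F])
      moreover have "(\<lambda>k. \<psi> s (E s k o\<^sub>L (F o\<^sub>L op_pow V (a s k)))) \<longlonglongrightarrow> 0" if "s \<in> {1..N}" for s
        using GW[OF that] unfolding a_def[symmetric] E_def[symmetric]
        by (intro sot_dual_null_sequence[where c = "norm F"] norm_pow_V)
          (use that F in \<open>simp_all add: \<psi> E bdd\<close>)
      ultimately have "(\<lambda>k. \<eta> k F) \<longlonglongrightarrow> \<phi> (?P n o\<^sub>L F) + (\<Sum>s\<in>{1..N}. 0)"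
        unfolding \<eta>_apply[OF F] by (intro tendsto_add tendsto_sum)
      then show "(\<lambda>k. \<eta> k F) \<longlonglongrightarrow> \<phi>P n F"
        using F by (simp add: \<phi>P_def dual_op_apply T_op_def)
    qed (simp_all add: \<eta>_dual \<phi>P_def dual_op_T_op_in_sot_dual \<phi> P_bdd id_in_bounded_ops)
    define \<theta> where "\<theta> l k = dual_op (T_op (op_pow U (a l k)) (op_pow (W l) (a l k))) (\<eta> k)" for l k
    have \<theta>_eq: "((dual_op (T_op U (W l)) ^^ r l) ^^ nk k) (\<eta> k) = \<theta> l k" if "l \<in> {1..N}" for l k
      using dual_op_T_op_pow[OF W_bdd[OF that] U_bdd sot_dual_extensional[OF \<eta>_dual]]
      by (simp add: \<theta>_def a_def funpow_mult mult.commute)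
    have \<theta>_lim: "limitin weak_star (\<theta> l) (\<psi>P l n) sequentially" if l: "l \<in> {1..N}" for l
    proof (rule limitin_weak_starI)
      fix F :: "'h \<Rightarrow>\<^sub>L 'h"
      assume F: "F \<in> bounded_ops"
      let ?X = "\<lambda>s k. F o\<^sub>L op_pow U (a l k) o\<^sub>L op_pow V (a s k)"
      have X: "?X s k \<in> bounded_ops" for s k
        using F by (simp add: bdd)
      have normX: "norm (?X s k) \<le> norm F" for s k
        by (rule order.trans[OF norm_pow_V norm_pow_U])
      have \<theta>_apply: "\<theta> l k F = \<phi> ((D k o\<^sub>L op_pow (W l) (a l k)) o\<^sub>L (F o\<^sub>L op_pow U (a l k)))
          + (\<Sum>s\<in>{1..N}. \<psi> s ((E s k o\<^sub>L op_pow (W l) (a l k)) o\<^sub>L ?X s k))" for k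
        using F l by (simp add: \<theta>_def dual_op_apply \<eta>_apply T_op_def bdd blinfun_compose_assoc)
      have "(\<lambda>k. \<phi> ((D k o\<^sub>L op_pow (W l) (a l k)) o\<^sub>L (F o\<^sub>L op_pow U (a l k)))) \<longlonglongrightarrow> 0"
        using DW[OF l] unfolding a_def[symmetric]
        by (intro sot_dual_null_sequence[where c = "norm F"] norm_pow_U)
          (use l F in \<open>simp_all add: \<phi> D bdd\<close>)
      moreover have "(\<lambda>k. \<psi> s ((E s k o\<^sub>L op_pow (W l) (a l k)) o\<^sub>L ?X s k))
          \<longlonglongrightarrow> (if s = l then \<psi> l (?P n o\<^sub>L F) else 0)" if s: "s \<in> {1..N}" for s
      proof (cases "s = l")
        case True
        \<comment> \<open>The powers of \<open>W\<^sub>l\<close> and of \<open>U\<close> cancel against those of their inverses.\<close>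
        have "(E l k o\<^sub>L op_pow (W l) (a l k)) o\<^sub>L ?X l k
            = G l k o\<^sub>L (op_pow (op_inv (W l)) (a l k) o\<^sub>L op_pow (W l) (a l k))
              o\<^sub>L F o\<^sub>L (op_pow U (a l k) o\<^sub>L op_pow V (a l k))" for k
          by (simp add: E_def blinfun_compose_assoc)
        then have "(E l k o\<^sub>L op_pow (W l) (a l k)) o\<^sub>L ?X l k = G l k o\<^sub>L F" for k
          by (simp add: op_pow_left_inverse W_inv(2)[OF l] UV)
        then show ?thesis
          using sot_dual_left_tendsto[OF \<psi>[OF l] G[OF l] G_lim[OF l] F] True by simp
      next
        case False
        have "(\<lambda>k. \<psi> s ((E s k o\<^sub>L op_pow (W l) (a l k)) o\<^sub>L ?X s k)) \<longlonglongrightarrow> 0"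
          using GWW[OF s l False] unfolding a_def[symmetric] E_def[symmetric]
          by (intro sot_dual_null_sequence[where c = "norm F"] normX X)
            (use s l in \<open>simp_all add: \<psi> E bdd\<close>)
        then show ?thesis
          using False by simp
      qed
      ultimately have "(\<lambda>k. \<theta> l k F)
          \<longlonglongrightarrow> 0 + (\<Sum>s\<in>{1..N}. if s = l then \<psi> l (?P n o\<^sub>L F) else 0)"
        unfolding \<theta>_apply by (intro tendsto_add tendsto_sum)
      then show "(\<lambda>k. \<theta> l k F) \<longlonglongrightarrow> \<psi>P l n F"
        using l F by (simp add: \<psi>P_def dual_op_apply T_op_def)
    qed (use l in \<open>simp_all add: \<theta>_def \<psi>P_def dual_op_T_op_in_sot_dual \<eta>_dual \<psi> P_bdd bdd
          id_in_bounded_ops\<close>)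
    have "\<forall>\<^sub>F k in sequentially. \<eta> k \<in> S"
      using \<eta>_lim S(1) \<phi>PS by (simp add: limitin_def)
    moreover have "\<forall>\<^sub>F k in sequentially. \<forall>l\<in>{1..N}. \<theta> l k \<in> O' l"
      using \<theta>_lim O' \<psi>PO by (intro eventually_ball_finite) (auto simp: limitin_def)
    ultimately have "\<forall>\<^sub>F k in sequentially. \<eta> k \<in> S \<and> (\<forall>l\<in>{1..N}. \<theta> l k \<in> O' l)"
      by eventually_elim blast
    then obtain k where "\<eta> k \<in> S" "\<forall>l\<in>{1..N}. \<theta> l k \<in> O' l"
      using eventually_happens'[OF sequentially_bot] by blast
    then have "\<eta> k \<in> S \<inter> (\<Inter>l\<in>{1..N}. {x \<in> topspace weak_star.
        ((dual_op (T_op U (W l)) ^^ r l) ^^ nk k) x \<in> O' l})"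
      using \<eta>_dual \<theta>_eq by simp
    then show "\<exists>n\<ge>1. S \<inter> (\<Inter>l\<in>{1..N}. {x \<in> topspace weak_star.
        ((dual_op (T_op U (W l)) ^^ r l) ^^ n) x \<in> O' l}) \<noteq> {}"
      using nk by blast
  qed
qed

end
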